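(* For Lebesgue-almost every $\alpha \in (0,1)\setminus\mathbb{Q}$, $$\lim_{N\to\infty} \frac{\#\{1\le n\le N : \#\Delta_n(\alpha)=2\}}{N} = 0.$$
   Context: For $x\in\mathbb{R}$, $\langle x\rangle = x \bmod 1$ denotes the fractional part. For $\alpha\in(0,1)\setminus\mathbb{Q}$ and $n\in\mathbb{N}$, let $P_n(\alpha)=\{\langle 0\alpha\rangle,\langle 1\alpha\rangle,\dots,\langle (n-1)\alpha\rangle, 1\}\subset[0,1]$. Arranging these points in increasing order, the lengths of the gaps between consecutive points form the set $\Delta_n(\alpha)$ of gap lengths, and $\#\Delta_n(\alpha)$ denotes the number of distinct gap lengths (so repeated lengths are counted once). *)

theory Defs
  imports "HOL-Analysis.Analysis"
begin

definition gap_points :: "nat \<Rightarrow> real \<Rightarrow> real set" where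
  "gap_points n \<alpha> = (\<lambda>k. frac (real k * \<alpha>)) ` {..<n} \<union> {1}"

text \<open>Two points of \<open>P\<close> are consecutive in the increasing order iff no point of \<open>P\<close>
  lies strictly between them. The result is a set, so repeated lengths are counted once.\<close>

definition gap_lengths :: "nat \<Rightarrow> real \<Rightarrow> real set" where
  "gap_lengths n \<alpha> =
     {y - x | x y. x \<in> gap_points n \<alpha> \<and> y \<in> gap_points n \<alpha> \<and> x < y \<and>
                   {x<..<y} \<inter> gap_points n \<alpha> = {}}"

end

theory Submission
  imports Defs
begin

text \<open>
  The limit vanishes for every irrational \<open>\<alpha>\<close>. For \<open>n \<ge> 2\<close> let \<open>u\<close> and \<open>v\<close> be the indices in
  \<open>{1..<n}\<close> that minimise and maximise \<open>\<langle>k\<alpha>\<rangle>\<close>, so that \<open>\<langle>u\<alpha>\<rangle>\<close> and \<open>1 - \<langle>v\<alpha>\<rangle>\<close> are the two (distinct)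
  gap lengths at the ends of \<open>[0,1]\<close>. If there are no other lengths, then \<open>n = u + v\<close>: otherwise
  \<open>u + v > n\<close>, and the gap to the right of \<open>\<langle>(n - u)\<alpha>\<rangle>\<close> would have to end at the point of
  index \<open>n\<close> or of index \<open>n - u - v < 0\<close>. Moreover \<open>\<langle>(u + v)\<alpha>\<rangle>\<close> always breaks one of the two
  records. Hence if \<open>n < n'\<close> both have two gap lengths and \<open>u'\<close>, \<open>v'\<close> belong to \<open>n'\<close>, then
  \<open>max u' v' \<ge> n\<close> and \<open>n' = u' + v' \<ge> n + min u' v'\<close>. Since \<open>\<langle>k\<alpha>\<rangle>\<close> accumulates at \<open>0\<close> and \<open>1\<close>,
  \<open>min u' v'\<close> tends to infinity, so the spacing of these \<open>n\<close> does too.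
\<close>

section \<open>Integer relations between an irrational and 1\<close>

lemma irrational_mult_int_eq_0:
  fixes \<alpha> :: real and m :: int
  assumes "\<alpha> \<notin> \<rat>" and "of_int m * \<alpha> \<in> \<int>"
  shows "m = 0"
proof (rule ccontr)
  assume "m \<noteq> 0"
  obtain k where "of_int m * \<alpha> = of_int k" using assms(2) by (elim Ints_cases)
  with \<open>m \<noteq> 0\<close> have "\<alpha> = of_int k / of_int m" by (simp add: field_simps)
  with assms(1) show False by auto
qed

lemma frac_mult_irrational_pos:
  fixes \<alpha> :: real
  assumes "\<alpha> \<notin> \<rat>" and "k > 0"
  shows "frac (real k * \<alpha>) > 0"
proof -
  have "real k * \<alpha> \<notin> \<int>"
    using irrational_mult_int_eq_0[OF assms(1), of "int k"] assms(2) by auto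
  then show ?thesis by simp
qed

text \<open>Modulo 1 the combination is (i - j - k + l)\<alpha>, so integrality forces the
  coefficient to vanish. This turns coincidences between gap lengths into equations between indices;
  index 0, with fractional part 0, fills spare slots.\<close>

lemma frac_diff_eq_irrational:
  fixes \<alpha> :: real and i j k l :: nat
  assumes "\<alpha> \<notin> \<rat>"
    and "frac (real i * \<alpha>) - frac (real j * \<alpha>) - frac (real k * \<alpha>) + frac (real l * \<alpha>) \<in> \<int>"
  shows "i + l = j + k"
proof -
  let ?s = "frac (real i * \<alpha>) - frac (real j * \<alpha>) - frac (real k * \<alpha>) + frac (real l * \<alpha>)"
  let ?t = "\<lfloor>real i * \<alpha>\<rfloor> - \<lfloor>real j * \<alpha>\<rfloor> - \<lfloor>real k * \<alpha>\<rfloor> + \<lfloor>real l * \<alpha>\<rfloor>"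
  have "of_int (int i - int j - int k + int l) * \<alpha> = ?s + of_int ?t"
    by (simp add: frac_def algebra_simps)
  also have "\<dots> \<in> \<int>" by (rule Ints_add[OF assms(2) Ints_of_int])
  finally have "int i - int j - int k + int l = 0"
    by (rule irrational_mult_int_eq_0[OF assms(1)])
  then show ?thesis by linarith
qed

section \<open>Record indices and the gaps at the two ends\<close>

definition extremal_indices :: "real \<Rightarrow> nat \<Rightarrow> nat \<Rightarrow> nat \<Rightarrow> bool" where
  "extremal_indices \<alpha> n u v \<longleftrightarrow> u \<in> {1..<n} \<and> v \<in> {1..<n} \<and>
     (\<forall>k\<in>{1..<n}. frac (real u * \<alpha>) \<le> frac (real k * \<alpha>) \<and> frac (real k * \<alpha>) \<le> frac (real v * \<alpha>))"

lemma extremal_indices_exist: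
  assumes "n \<ge> 2"
  obtains u v where "extremal_indices \<alpha> n u v"
proof -
  let ?f = "\<lambda>k. frac (real k * \<alpha>)"
  have fin: "finite (?f ` {1..<n})" "?f ` {1..<n} \<noteq> {}" using assms by auto
  obtain u where u: "u \<in> {1..<n}" "?f u = Min (?f ` {1..<n})"
    using Min_in[OF fin] by auto
  obtain v where v: "v \<in> {1..<n}" "?f v = Max (?f ` {1..<n})"
    using Max_in[OF fin] by auto
  have "extremal_indices \<alpha> n u v"
    using u v fin by (auto simp: extremal_indices_def)
  then show thesis by (rule that)
qed

text \<open>Without a carry the fractional parts add up, exceeding the one at v because the one at u
  is positive. With a carry the sum drops by 1, falling below the one at u because the one at v is
  less than 1.\<close>

lemma frac_add_breaks_record:
  assumes "\<alpha> \<notin> \<rat>" and "extremal_indices \<alpha> n u v"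
  shows "frac (real (u + v) * \<alpha>) < frac (real u * \<alpha>) \<or> frac (real (u + v) * \<alpha>) > frac (real v * \<alpha>)"
proof -
  have "frac (real u * \<alpha>) > 0"
    using assms frac_mult_irrational_pos by (auto simp: extremal_indices_def)
  moreover have "frac (real v * \<alpha>) < 1" by (rule frac_lt_1)
  ultimately show ?thesis
    using frac_add[of "real u * \<alpha>" "real v * \<alpha>"] by (auto simp: distrib_right)
qed

lemma extremal_gaps_mem:
  assumes "\<alpha> \<notin> \<rat>" and "extremal_indices \<alpha> n u v"
  shows "frac (real u * \<alpha>) \<in> gap_lengths n \<alpha>" and "1 - frac (real v * \<alpha>) \<in> gap_lengths n \<alpha>"
proof -
  let ?f = "\<lambda>k. frac (real k * \<alpha>)"
  have uv: "u \<in> {1..<n}" "v \<in> {1..<n}"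
    and ext: "\<And>k. k \<in> {1..<n} \<Longrightarrow> ?f u \<le> ?f k \<and> ?f k \<le> ?f v"
    using assms(2) by (auto simp: extremal_indices_def)
  have pos: "?f u > 0" "?f v > 0" using assms(1) uv frac_mult_irrational_pos by auto
  have P: "z = 0 \<or> z = 1 \<or> (\<exists>k\<in>{1..<n}. z = ?f k)" if z: "z \<in> gap_points n \<alpha>" for z
  proof -
    consider "z = 1" | k where "k < n" "z = ?f k"
      using z by (auto simp: gap_points_def)
    then show ?thesis
    proof cases
      case (2 k)
      then show ?thesis by (cases "k = 0") auto
    qed simp
  qed
  have mem: "0 \<in> gap_points n \<alpha>" "1 \<in> gap_points n \<alpha>" "?f u \<in> gap_points n \<alpha>" "?f v \<in> gap_points n \<alpha>"
    using uv image_eqI[of 0 ?f 0 "{..<n}"] by (auto simp: gap_points_def)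
  have "z \<notin> gap_points n \<alpha>" if "0 < z" "z < ?f u" for z
    using P[of z] that ext frac_lt_1[of "real u * \<alpha>"] by (auto simp: not_less[symmetric])
  then have "{0<..<?f u} \<inter> gap_points n \<alpha> = {}" by auto
  then have "?f u - 0 \<in> gap_lengths n \<alpha>"
    using mem pos(1) unfolding gap_lengths_def by blast
  then show "?f u \<in> gap_lengths n \<alpha>" by simp
  have "z \<notin> gap_points n \<alpha>" if "?f v < z" "z < 1" for z
    using P[of z] that ext pos by (auto simp: not_less[symmetric])
  then have "{?f v<..<1} \<inter> gap_points n \<alpha> = {}" by auto
  then show "1 - ?f v \<in> gap_lengths n \<alpha>"
    using mem frac_lt_1[of "real v * \<alpha>"] by (auto simp: gap_lengths_def)
qed

lemma gap_to_the_right: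
  assumes "x \<in> gap_points n \<alpha>" and "x < 1"
  obtains y where "y \<in> gap_points n \<alpha>" "y > x" "y - x \<in> gap_lengths n \<alpha>"
proof -
  let ?S = "{y \<in> gap_points n \<alpha>. y > x}"
  have fin: "finite ?S" by (simp add: gap_points_def)
  have ne: "?S \<noteq> {}" using assms by (auto simp: gap_points_def)
  have y: "Min ?S \<in> ?S" by (rule Min_in[OF fin ne])
  have "{x<..<Min ?S} \<inter> gap_points n \<alpha> = {}"
    using Min_le[OF fin] by fastforce
  then have "Min ?S - x \<in> gap_lengths n \<alpha>"
    using y assms(1) unfolding gap_lengths_def by blast
  with y show thesis by (intro that[of "Min ?S"]) auto
qed

lemma two_gap_lengths_index_sum:
  assumes irr: "\<alpha> \<notin> \<rat>" and ext: "extremal_indices \<alpha> n u v"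
    and two: "card (gap_lengths n \<alpha>) = 2"
  shows "n = u + v"
proof (rule ccontr)
  let ?f = "\<lambda>k. frac (real k * \<alpha>)"
  assume "n \<noteq> u + v"
  have uv: "u \<in> {1..<n}" "v \<in> {1..<n}"
    using ext by (auto simp: extremal_indices_def)
  have "\<not> u + v < n"
  proof
    assume "u + v < n"
    then have "u + v \<in> {1..<n}" using uv by auto
    with ext have "?f u \<le> ?f (u + v)" "?f (u + v) \<le> ?f v"
      unfolding extremal_indices_def by blast+
    with frac_add_breaks_record[OF irr ext] show False by linarith
  qed
  with \<open>n \<noteq> u + v\<close> have less: "n < u + v" by linarith
  \<comment> \<open>Equality would make (u + v)\<alpha> an integer. Once distinct, these two lengths
    exhaust the set of gap lengths.\<close>
  have "?f u \<noteq> 1 - ?f v"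
  proof
    assume "?f u = 1 - ?f v"
    then have "?f u - ?f 0 - ?f 0 + ?f v \<in> \<int>" by simp
    from frac_diff_eq_irrational[OF irr this] uv show False by simp
  qed
  with two extremal_gaps_mem[OF irr ext] have gaps: "gap_lengths n \<alpha> = {?f u, 1 - ?f v}"
    by (auto simp: card_2_iff)
  define k where "k = n - u"
  have k: "0 < k" "k < v" "k + u = n" using uv less by (auto simp: k_def)
  have "?f k \<in> gap_points n \<alpha>" using k uv by (auto simp: gap_points_def)
  then obtain y where y: "y \<in> gap_points n \<alpha>" "y > ?f k" "y - ?f k \<in> gap_lengths n \<alpha>"
    by (rule gap_to_the_right[OF _ frac_lt_1])
  have "0 < n" using uv by auto
  \<comment> \<open>The endpoint 1 is not a fractional part. Taking j = 0 for it covers this case,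
    at the price of fixing y only modulo 1.\<close>
  then obtain j where j: "j < n" "y - ?f j \<in> \<int>"
    using y(1) by (force simp: gap_points_def)
  from y(3) consider "y - ?f k = ?f u" | "y - ?f k = 1 - ?f v" unfolding gaps by blast
  then show False
  proof cases
    case 1
    have "?f j - ?f k - ?f u + ?f 0 = - (y - ?f j)" using 1 by simp
    also have "\<dots> \<in> \<int>" using j(2) by (rule Ints_minus)
    finally have "j + 0 = k + u" by (rule frac_diff_eq_irrational[OF irr])
    with k j(1) show False by simp
  next
    case 2
    have "?f j - ?f k - ?f 0 + ?f v = 1 - (y - ?f j)" using 2 by simp
    also have "\<dots> \<in> \<int>" by (rule Ints_diff[OF Ints_1 j(2)])
    finally have "j + v = k + 0" by (rule frac_diff_eq_irrational[OF irr])
    with k show False by simp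
  qed
qed

section \<open>Growth of the record indices and spacing\<close>

text \<open>The finitely many indices in \<open>{1..<M}\<close> stay at distance at least some
  \<epsilon> from both 0 and 1. Kronecker approximation yields indices closer to 0 and to 1 than
  that, and once these are in range no index below M can hold a record.\<close>

lemma extremal_indices_at_top:
  assumes "\<alpha> \<notin> \<rat>"
  obtains n0 where "\<And>n u v. n \<ge> n0 \<Longrightarrow> extremal_indices \<alpha> n u v \<Longrightarrow> M \<le> u \<and> M \<le> v"
proof -
  let ?f = "\<lambda>k. frac (real k * \<alpha>)"
  \<comment> \<open>The inserted 1 keeps \<open>Min\<close> meaningful when \<open>{1..<M}\<close>
    is empty.\<close>
  define \<epsilon> where "\<epsilon> = Min (insert 1 ((\<lambda>k. min (?f k) (1 - ?f k)) ` {1..<M}))"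
  have fin: "finite (insert 1 ((\<lambda>k. min (?f k) (1 - ?f k)) ` {1..<M}))" by simp
  have "\<epsilon> > 0"
    unfolding \<epsilon>_def using frac_mult_irrational_pos[OF assms] by (subst Min_gr_iff) (auto simp: frac_lt_1)
  have le: "\<epsilon> \<le> ?f k" "\<epsilon> \<le> 1 - ?f k" if "k \<in> {1..<M}" for k
  proof -
    have "\<epsilon> \<le> min (?f k) (1 - ?f k)"
      unfolding \<epsilon>_def using that by (intro Min_le[OF fin]) auto
    then show "\<epsilon> \<le> ?f k" "\<epsilon> \<le> 1 - ?f k" by auto
  qed
  obtain a where a: "a > 0" "\<bar>?f a - 0\<bar> < \<epsilon>"
    using Kronecker_approx_1_explicit[OF assms, of 0 \<epsilon>] \<open>\<epsilon> > 0\<close> by auto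
  obtain b where b: "b > 0" "\<bar>?f b - 1\<bar> < \<epsilon>"
    using Kronecker_approx_1_explicit[OF assms, of 1 \<epsilon>] \<open>\<epsilon> > 0\<close> by auto
  show thesis
  proof (rule that)
    fix n u v
    assume n: "n \<ge> Suc (max a b)" and ext: "extremal_indices \<alpha> n u v"
    have ab: "a \<in> {1..<n}" "b \<in> {1..<n}" using n a(1) b(1) by auto
    have "?f u \<le> ?f a" "?f b \<le> ?f v" "u \<ge> 1" "v \<ge> 1"
      using ext ab by (auto simp: extremal_indices_def)
    then have "u \<notin> {1..<M}" "v \<notin> {1..<M}"
      using a(2) b(2) le(1)[of u] le(2)[of v] by auto
    with \<open>u \<ge> 1\<close> \<open>v \<ge> 1\<close> show "M \<le> u \<and> M \<le> v" by auto
  qed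
qed

lemma two_gap_lengths_spacing:
  assumes irr: "\<alpha> \<notin> \<rat>"
  obtains n0 where "\<And>n n'. n0 \<le> n \<Longrightarrow> n < n' \<Longrightarrow> card (gap_lengths n \<alpha>) = 2 \<Longrightarrow>
    card (gap_lengths n' \<alpha>) = 2 \<Longrightarrow> n + M \<le> n'"
proof -
  obtain n0 where n0: "\<And>n u v. n \<ge> n0 \<Longrightarrow> extremal_indices \<alpha> n u v \<Longrightarrow> M \<le> u \<and> M \<le> v"
    using extremal_indices_at_top[OF irr] by blast
  show thesis
  proof (rule that)
    fix n n'
    assume n: "max 2 n0 \<le> n" "n < n'"
      and two: "card (gap_lengths n \<alpha>) = 2" and two': "card (gap_lengths n' \<alpha>) = 2"
    obtain u v where ext: "extremal_indices \<alpha> n u v" using extremal_indices_exist[of n] n by auto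
    obtain u' v' where ext': "extremal_indices \<alpha> n' u' v'" using extremal_indices_exist[of n'] n by auto
    have sum: "n = u + v" "n' = u' + v'"
      using two_gap_lengths_index_sum[OF irr] ext ext' two two' by auto
    have big: "M \<le> u'" "M \<le> v'" using n0[OF _ ext'] n by auto
    have "n \<in> {1..<n'}" using n by auto
    then have rec': "frac (real u' * \<alpha>) \<le> frac (real n * \<alpha>)" "frac (real n * \<alpha>) \<le> frac (real v' * \<alpha>)"
      using ext' unfolding extremal_indices_def by blast+
    have pos: "u' \<ge> 1" "v' \<ge> 1" using ext' by (auto simp: extremal_indices_def)
    have rec: "frac (real u * \<alpha>) \<le> frac (real k * \<alpha>)" "frac (real k * \<alpha>) \<le> frac (real v * \<alpha>)"
      if "1 \<le> k" "k < n" for k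
      using ext that by (auto simp: extremal_indices_def)
    \<comment> \<open>If both u' and v' were below n, their values would lie between the records of
      n, and the value at n = u + v lies between theirs, so it could not break a record.\<close>
    have "n \<le> u' \<or> n \<le> v'"
      using frac_add_breaks_record[OF irr ext] rec' rec(1)[of u'] rec(2)[of v'] pos
      unfolding sum(1)[symmetric] by linarith
    then show "n + M \<le> n'" using sum(2) big by linarith
  qed
qed

section \<open>From spacing to density zero\<close>

text \<open>Beyond n0, each block of M integers with the same quotient \<open>n div M\<close>
  contains at most one element of A. The count up to N is therefore at most n0 + 1 + N / M, where M
  is arbitrary.\<close>

lemma density_zero_if_spacing_at_top:
  fixes A :: "nat set"
  assumes spacing: "\<And>M. \<exists>n0. \<forall>n\<in>A. \<forall>n'\<in>A. n0 \<le> n \<longrightarrow> n < n' \<longrightarrow> n + M \<le> n'"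
  shows "(\<lambda>N. real (card (A \<inter> {1..N})) / real N) \<longlonglongrightarrow> 0"
proof (rule LIMSEQ_I)
  fix r :: real
  assume "r > 0"
  obtain M :: nat where M: "M > 0" "1 / real M < r / 2"
    using real_arch_inverse[of "r / 2"] \<open>r > 0\<close> by (auto simp: inverse_eq_divide)
  obtain n0 where n0: "\<And>n n'. n \<in> A \<Longrightarrow> n' \<in> A \<Longrightarrow> n0 \<le> n \<Longrightarrow> n < n' \<Longrightarrow> n + M \<le> n'"
    using spacing[of M] by blast
  have bound: "real (card (A \<inter> {1..N})) \<le> real (n0 + 1) + real N / real M" for N
  proof -
    have less: "n div M < n' div M" if "n \<in> A" "n' \<in> A" "n0 \<le> n" "n < n'" for n n'
    proof -
      have "Suc (n div M) = (n + M) div M" using M(1) by simp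
      also have "\<dots> \<le> n' div M" using n0[OF that] by (rule div_le_mono)
      finally show ?thesis by simp
    qed
    have "inj_on (\<lambda>n. n div M) (A \<inter> {n0..N})"
      by (rule linorder_inj_onI') (use less in force)
    moreover have "(\<lambda>n. n div M) ` (A \<inter> {n0..N}) \<subseteq> {..N div M}"
      by (auto intro: div_le_mono)
    ultimately have "card (A \<inter> {n0..N}) \<le> card {..N div M}"
      by (intro card_inj_on_le) auto
    then have "card (A \<inter> {n0..N}) \<le> N div M + 1" by simp
    moreover have "card (A \<inter> {1..N}) \<le> card ({..<n0} \<union> (A \<inter> {n0..N}))"
      by (intro card_mono) auto
    moreover have "\<dots> \<le> card {..<n0} + card (A \<inter> {n0..N})" by (rule card_Un_le)
    ultimately have "card (A \<inter> {1..N}) \<le> n0 + 1 + N div M" by simp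
    then have "real (card (A \<inter> {1..N})) \<le> real (n0 + 1) + real (N div M)"
      by (metis of_nat_add of_nat_le_iff)
    also have "real (N div M) \<le> real N / real M" by (rule of_nat_div_le_of_nat)
    finally show ?thesis by simp
  qed
  \<comment> \<open>From here on the constant n0 + 1 contributes less than r / 2 to the quotient;
    the choice of M gave the other half.\<close>
  obtain N0 :: nat where N0: "real N0 > 2 * real (n0 + 1) / r" using reals_Archimedean2 by blast
  show "\<exists>no. \<forall>N\<ge>no. norm (real (card (A \<inter> {1..N})) / real N - 0) < r"
  proof (intro exI allI impI)
    fix N
    assume "N \<ge> Suc N0"
    then have "N > 0" and "real N > 2 * real (n0 + 1) / r" using N0 by linarith+
    then have "real (n0 + 1) / real N < r / 2" using \<open>r > 0\<close> by (simp add: field_simps)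
    have "real (card (A \<inter> {1..N})) / real N \<le> (real (n0 + 1) + real N / real M) / real N"
      using bound by (rule divide_right_mono) simp
    also have "\<dots> = real (n0 + 1) / real N + 1 / real M"
      using \<open>N > 0\<close> by (simp add: add_divide_distrib)
    also have "\<dots> < r" using \<open>real (n0 + 1) / real N < r / 2\<close> M(2) by linarith
    finally show "norm (real (card (A \<inter> {1..N})) / real N - 0) < r" by simp
  qed
qed

lemma two_gap_lengths_density_zero:
  assumes "\<alpha> \<notin> \<rat>"
  shows "(\<lambda>N. real (card {n \<in> {1..N}. card (gap_lengths n \<alpha>) = 2}) / real N) \<longlonglongrightarrow> 0"
proof -
  let ?A = "{n. card (gap_lengths n \<alpha>) = 2}"
  have "(\<lambda>N. real (card (?A \<inter> {1..N})) / real N) \<longlonglongrightarrow> 0"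
  proof (rule density_zero_if_spacing_at_top)
    fix M
    show "\<exists>n0. \<forall>n\<in>?A. \<forall>n'\<in>?A. n0 \<le> n \<longrightarrow> n < n' \<longrightarrow> n + M \<le> n'"
      by (rule two_gap_lengths_spacing[OF assms, of M]) blast
  qed
  moreover have "?A \<inter> {1..N} = {n \<in> {1..N}. card (gap_lengths n \<alpha>) = 2}" for N by auto
  ultimately show ?thesis by simp
qed

theorem theorem1:
  shows "AE \<alpha> in lebesgue. \<alpha> \<in> {0<..<1} - \<rat> \<longrightarrow>
    (\<lambda>N. real (card {n \<in> {1..N}. card (gap_lengths n \<alpha>) = 2}) / real N) \<longlonglongrightarrow> 0"
  by (intro AE_I2) (use two_gap_lengths_density_zero in auto)

end
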